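(* For every real symmetric $n\times n$ matrix $s$, $$\log\det\mathrm{Cay}(s)=-2\mathrm{i}\,\mathrm{tr}\,\arctan s\qquad(\text{modulo }2\pi\mathrm{i}).$$ Consequently, the angle $\theta$ between the Lagrangian plane represented by $s$ and the standard reference plane, which is defined modulo $2\pi$ by $\mathrm{e}^{\mathrm{i}\theta}=\det\mathrm{Cay}(s)$, is given by $\theta=-2\,\mathrm{tr}\,\arctan s$ (modulo $2\pi$).
   Context: The Cayley transform of a real symmetric matrix $s$ is $\mathrm{Cay}(s)=(\mathrm{id}-\mathrm{i}s)(\mathrm{id}+\mathrm{i}s)^{-1}$, a unitary symmetric matrix. The Lagrangian plane represented by $s$ is the column span of $\begin{pmatrix} \mathrm{id} \\ s \end{pmatrix}$ in $\mathbb{R}^{2n}$, and the standard reference plane is the column span of $\begin{pmatrix} O \\ \mathrm{id} \end{pmatrix}$. The matrix $\arctan s$ is defined by the functional calculus for real symmetric matrices (with $\arctan\colon\mathbb{R}\to(-\pi/2,\pi/2)$). *)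

theory Defs
  imports "HOL-Analysis.Analysis" "HOL-Library.Real_Mod"
begin

definition diag_matrix :: "real^'n \<Rightarrow> real^'n^'n" where
  "diag_matrix d = (\<chi> i j. if i = j then d $ i else 0)"

text \<open>
  Functional calculus for real symmetric matrices: write
  \<open>s = Q diag(d) Q\<^sup>T\<close> with \<open>Q\<close> orthogonal and
  apply \<open>f\<close> to the eigenvalues. Such a \<open>Q\<close> exists by the spectral
  theorem, and the result does not depend on its choice
  (\<open>sym_matrix_fun_eqI\<close> below). For non-symmetric \<open>s\<close> the
  value is unspecified.
\<close>

definition sym_matrix_fun :: "(real \<Rightarrow> real) \<Rightarrow> real^'n^'n \<Rightarrow> real^'n^'n" where
  "sym_matrix_fun f s =
     (THE t. \<exists>Q d. orthogonal_matrix Q \<and> s = Q ** diag_matrix d ** transpose Q \<and>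
                   t = Q ** diag_matrix (\<chi> i. f (d $ i)) ** transpose Q)"

definition arctan_matrix :: "real^'n^'n \<Rightarrow> real^'n^'n" where
  "arctan_matrix s = sym_matrix_fun arctan s"

text \<open>
  The inverse is a genuine one for symmetric \<open>s\<close>, see
  \<open>invertible_id_plus_i\<close> below.
\<close>

definition cayley :: "real^'n^'n \<Rightarrow> complex^'n^'n" where
  "cayley s = (mat 1 - map_matrix (\<lambda>x. \<i> * complex_of_real x) s) **
              matrix_inv (mat 1 + map_matrix (\<lambda>x. \<i> * complex_of_real x) s)"

text \<open>
  \<open>\<real>\<^sup>2\<^sup>n\<close> is indexed by the disjoint sum \<open>'n + 'n\<close>; \<open>stack A B\<close>
  is the block matrix with \<open>A\<close> on top of \<open>B\<close>.
\<close>

definition stack :: "real^'n^'n \<Rightarrow> real^'n^'n \<Rightarrow> real^'n^('n + 'n)" where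
  "stack A B = (\<chi> r. case r of Inl i \<Rightarrow> A $ i | Inr i \<Rightarrow> B $ i)"

definition lagrangian_plane :: "real^'n^'n \<Rightarrow> (real^('n + 'n)) set" where
  "lagrangian_plane s = span (columns (stack (mat 1) s))"

definition reference_plane :: "(real^('n::finite + 'n)) set" where
  "reference_plane = span (columns (stack 0 (mat 1)))"

text \<open>
  \<open>is_plane_angle L M \<theta>\<close>: the real number \<open>\<theta>\<close> is a determination of the
  angle between \<open>L\<close> and \<open>M\<close>, for \<open>M\<close> the standard reference plane and
  \<open>L\<close> a plane represented by a symmetric matrix. The angle is only defined
  modulo \<open>2\<pi>\<close>, hence a relation. The representing matrix is determined by
  the plane (\<open>lagrangian_plane_inj\<close> below).
\<close>

definition is_plane_angle ::
    "(real^('n::finite + 'n)) set \<Rightarrow> (real^('n + 'n)) set \<Rightarrow> real \<Rightarrow> bool" where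
  "is_plane_angle L M \<theta> \<longleftrightarrow>
     M = reference_plane \<and>
     (\<exists>s. transpose s = s \<and> L = lagrangian_plane s \<and>
          exp (\<i> * complex_of_real \<theta>) = det (cayley s))"

lemma diag_conj_imp_fun_conj:
  fixes Q P :: "real^'n^'n"
  assumes Q: "orthogonal_matrix Q" and P: "orthogonal_matrix P"
    and eq: "Q ** diag_matrix d ** transpose Q = P ** diag_matrix e ** transpose P"
  shows "Q ** diag_matrix (\<chi> i. f (d $ i)) ** transpose Q =
         P ** diag_matrix (\<chi> i. f (e $ i)) ** transpose P"
proof -
  define U where "U = transpose P ** Q"
  have QQ: "transpose Q ** Q = mat 1" "Q ** transpose Q = mat 1"
    and PP: "transpose P ** P = mat 1" "P ** transpose P = mat 1"
    using Q P by (auto simp: orthogonal_matrix_def)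
  have dl: "(diag_matrix v ** A) $ i $ j = v $ i * A $ i $ j"
    and dr: "(A ** diag_matrix v) $ i $ j = A $ i $ j * v $ j" for v and A :: "real^'n^'n" and i j
    by (simp_all add: diag_matrix_def matrix_matrix_mult_def if_distrib if_distribR sum.delta
          cong: if_cong)
  have "U ** diag_matrix d = transpose P ** (Q ** diag_matrix d ** transpose Q) ** Q"
    by (metis QQ(1) U_def matrix_mul_assoc matrix_mul_rid)
  also have "\<dots> = diag_matrix e ** U"
    unfolding eq by (metis PP(1) U_def matrix_mul_assoc matrix_mul_lid)
  finally have "U $ i $ j = 0 \<or> d $ j = e $ i" for i j
    using dl[of e U i j] dr[of U d i j] by auto
  then have "U ** diag_matrix (\<chi> i. f (d $ i)) = diag_matrix (\<chi> i. f (e $ i)) ** U"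
    unfolding vec_eq_iff dl dr by (metis mult.commute mult_zero_left vec_lambda_beta)
  then have "P ** (U ** diag_matrix (\<chi> i. f (d $ i))) ** transpose Q =
             P ** (diag_matrix (\<chi> i. f (e $ i)) ** U) ** transpose Q"
    by simp
  then show ?thesis
    by (metis PP(2) QQ(2) U_def matrix_mul_assoc matrix_mul_lid matrix_mul_rid)
qed

lemma sym_matrix_fun_eqI:
  fixes Q :: "real^'n^'n"
  assumes "orthogonal_matrix Q"
  shows "sym_matrix_fun f (Q ** diag_matrix d ** transpose Q) =
         Q ** diag_matrix (\<chi> i. f (d $ i)) ** transpose Q"
  unfolding sym_matrix_fun_def
proof (rule the_equality)
  fix t
  assume "\<exists>P e. orthogonal_matrix P \<and>
            Q ** diag_matrix d ** transpose Q = P ** diag_matrix e ** transpose P \<and>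
            t = P ** diag_matrix (\<chi> i. f (e $ i)) ** transpose P"
  then obtain P e where P: "orthogonal_matrix P"
      "Q ** diag_matrix d ** transpose Q = P ** diag_matrix e ** transpose P"
    and t: "t = P ** diag_matrix (\<chi> i. f (e $ i)) ** transpose P"
    by (elim exE conjE)
  show "t = Q ** diag_matrix (\<chi> i. f (d $ i)) ** transpose Q"
    unfolding t by (rule diag_conj_imp_fun_conj [OF assms P, symmetric])
qed (rule exI [of _ Q], rule exI [of _ d], intro conjI assms refl)

lemma invertible_id_plus_i:
  fixes s :: "real^'n^'n"
  assumes s: "transpose s = s"
  shows "invertible (mat 1 + map_matrix (\<lambda>x. \<i> * complex_of_real x) s)" (is "invertible ?A")
proof -
  have "v = 0" if v: "?A *v v = 0" for v
  proof -
    define x where "x = (\<chi> i. Re (v $ i))"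
    define y where "y = (\<chi> i. Im (v $ i))"
    have *: "v $ i + (\<Sum>j\<in>UNIV. \<i> * complex_of_real (s $ i $ j) * v $ j) = 0" for i
      using arg_cong[OF v, of "\<lambda>w. w $ i"]
      by (simp add: matrix_vector_mult_add_rdistrib)
         (simp add: matrix_vector_mult_def map_matrix_def)
    have "x = s *v y"
      unfolding vec_eq_iff
    proof
      fix i show "x $ i = (s *v y) $ i"
        using arg_cong[OF *[of i], of Re]
        by (simp add: x_def y_def matrix_vector_mult_def sum_negf)
    qed
    moreover have "y = - (s *v x)"
      unfolding vec_eq_iff
    proof
      fix i show "y $ i = (- (s *v x)) $ i"
        using arg_cong[OF *[of i], of Im]
        by (simp add: x_def y_def matrix_vector_mult_def)
    qed
    moreover have "inner (s *v y) x = inner y (s *v x)"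
      by (metis dot_lmul_matrix s vector_transpose_matrix)
    ultimately have "inner x x = - inner y y" by (metis inner_minus_right minus_minus)
    then have "x = 0" "y = 0"
      by (smt (verit) inner_ge_zero inner_eq_zero_iff)+
    then show "v = 0"
      by (auto simp: x_def y_def vec_eq_iff complex_eq_iff)
  qed
  then show ?thesis
    by (metis invertible_left_inverse matrix_left_invertible_ker)
qed

lemma lagrangian_plane_inj:
  assumes "lagrangian_plane s = lagrangian_plane t"
  shows "s = t"
proof -
  have span_eq: "span (columns A) = range ((*v) A)" for A :: "real^'n^('n + 'n)"
  proof
    have "columns A \<subseteq> range ((*v) A)"
      by (auto simp: columns_image_basis)
    then show "span (columns A) \<subseteq> range ((*v) A)"
      by (intro span_minimal linear_subspace_image) auto
  qed (auto simp: matrix_vector_mult_in_columnspace)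
  have block: "(stack (mat 1) u *v v) $ Inl i = v $ i" "(stack (mat 1) u *v v) $ Inr i = (u *v v) $ i"
    for u :: "real^'n^'n" and v i
    by (simp_all add: stack_def matrix_vector_mult_def mat_def if_distrib if_distribR
          cong: if_cong)
  have "s *v v = t *v v" for v
  proof -
    have "stack (mat 1) s *v v \<in> range ((*v) (stack (mat 1) t))"
      using assms unfolding lagrangian_plane_def span_eq by auto
    then obtain w where w: "stack (mat 1) s *v v = stack (mat 1) t *v w" by auto
    then have "v = w" by (metis block(1) vec_eq_iff)
    then show ?thesis using w by (metis block(2) vec_eq_iff)
  qed
  then show ?thesis by (simp add: matrix_eq)
qed

end

theory Submission
  imports Defs
begin

text \<open>
  Diagonalise \<open>s = Q diag(d) Q\<^sup>T\<close> by the spectral theorem. Conjugation by \<open>Q\<close> reduces both sides to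
  the eigenvalues: \<open>det (Cay s)\<close> is the product of the \<open>(1 - \<i>d\<^sub>i) / (1 + \<i>d\<^sub>i)\<close>, while
  \<open>tr (arctan s)\<close> is the sum of the \<open>arctan d\<^sub>i\<close>. Since \<open>1 + \<i>x\<close> has argument \<open>arctan x\<close>, each
  factor is \<open>exp (-2\<i> arctan d\<^sub>i)\<close>.
\<close>

section \<open>Spectral theorem for real symmetric matrices\<close>

text \<open>
  The maximiser \<open>x\<close> of \<open>y \<bullet> f y\<close> on the unit sphere is an eigenvector: the form
  \<open>g y = \<lambda> (y \<bullet> y) - y \<bullet> f y\<close> is nonnegative and vanishes at \<open>x\<close>, so its derivative at \<open>x\<close> in the
  direction \<open>\<lambda> x - f x\<close> must vanish.
\<close>

lemma self_adjoint_eigenvector_exists: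
  fixes f :: "'a::euclidean_space \<Rightarrow> 'a"
  assumes f: "linear f" and sa: "\<And>x y. inner (f x) y = inner x (f y)"
    and S: "subspace S" "f ` S \<subseteq> S" "S \<noteq> {0}"
  obtains x l where "x \<in> S" "norm x = 1" "f x = l *\<^sub>R x"
proof -
  let ?K = "S \<inter> sphere 0 1"
  have "compact ?K"
    using closed_subspace[OF S(1)] by (simp add: closed_Int_compact)
  moreover obtain z where z: "z \<in> S" "z \<noteq> 0"
    using S subspace_0 by blast
  then have "z /\<^sub>R norm z \<in> ?K"
    using S(1) by (auto simp: subspace_scale)
  then have "?K \<noteq> {}" by blast
  moreover have "continuous_on ?K (\<lambda>y. inner y (f y))"
    by (intro continuous_intros linear_continuous_on) (simp add: f linear_conv_bounded_linear[symmetric])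
  ultimately obtain x where x: "x \<in> ?K" and max: "\<And>y. y \<in> ?K \<Longrightarrow> inner y (f y) \<le> inner x (f x)"
    using continuous_attains_sup by (metis (no_types, lifting))
  define l where "l = inner x (f x)"
  define g where "g y = l * inner y y - inner y (f y)" for y
  have xx: "inner x x = 1" "norm x = 1" using x by (auto simp: norm_eq_1)
  have g_nonneg: "g y \<ge> 0" if "y \<in> S" for y
  proof (cases "y = 0")
    case False
    \<comment> \<open>Both terms of \<open>g\<close> are homogeneous of degree 2, so the bound on
      the unit sphere extends to all of \<open>S\<close>.\<close>
    have "y /\<^sub>R norm y \<in> ?K"
      using S(1) that False by (auto simp: subspace_scale)
    from max[OF this] have "inner y (f y) / (norm y)\<^sup>2 \<le> l"
      using f by (simp add: linear_cmul l_def divide_inverse power2_eq_square algebra_simps)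
    then show ?thesis
      using False by (simp add: g_def divide_le_eq flip: power2_norm_eq_inner)
  qed (simp add: g_def)
  define h where "h = l *\<^sub>R x - f x"
  have hS: "h \<in> S"
    using x S by (auto simp: h_def intro!: subspace_diff subspace_scale)
  define a where "a = inner h h"
  define b where "b = g h"
  \<comment> \<open>The constant term \<open>g x\<close> is 0 since \<open>x\<close> has norm 1;
    self-adjointness merges the two cross terms into twice \<open>inner h h\<close>.\<close>
  have expand: "g (x + t *\<^sub>R h) = 2 * t * a + t\<^sup>2 * b" for t
  proof -
    have "inner x (f h) = inner h (f x)"
      by (metis sa inner_commute)
    moreover have "a = l * inner x h - inner h (f x)"
      by (simp add: a_def h_def inner_diff_left inner_diff_right inner_commute algebra_simps)
    moreover have "g (x + t *\<^sub>R h) =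
        2 * t * (l * inner x h) - t * (inner x (f h) + inner h (f x)) + t\<^sup>2 * b"
      using xx f
      by (simp add: g_def b_def linear_add linear_cmul inner_add_left inner_add_right
          inner_commute[of h x] algebra_simps power2_eq_square flip: l_def)
    ultimately show ?thesis
      by (simp only:) (simp add: algebra_simps)
  qed
  have b0: "b \<ge> 0" using g_nonneg hS by (simp add: b_def)
  \<comment> \<open>Close to the minimiser \<open>- a / b\<close> of the quadratic, with denominator
    \<open>b + 1\<close> so that \<open>b = 0\<close> is covered. The value at this \<open>t\<close>
    is negative unless \<open>a = 0\<close>.\<close>
  define t where "t = - a / (b + 1)"
  have "0 \<le> g (x + t *\<^sub>R h)"
    using x hS S(1) by (intro g_nonneg) (auto intro!: subspace_add subspace_scale)
  also have "\<dots> = - (a\<^sup>2 * (b + 2)) / (b + 1)\<^sup>2"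
    unfolding expand t_def using b0 by (simp add: divide_simps) (simp add: algebra_simps power2_eq_square)
  finally have "a\<^sup>2 * (b + 2) \<le> 0"
    using b0 by (simp add: divide_le_0_iff)
  then have "a = 0"
    using b0 by (simp add: mult_le_0_iff)
  then have "f x = l *\<^sub>R x"
    by (simp add: a_def h_def)
  then show ?thesis using that x xx by blast
qed

text \<open>Induction on the dimension: split off a unit eigenvector \<open>x\<close>. Its
  orthogonal complement \<open>T\<close> in \<open>S\<close> is invariant again, because
  \<open>inner x (f y) = inner (f x) y\<close> is a multiple of \<open>inner x y\<close>. Working in
  invariant subspaces lets the induction hypothesis apply to \<open>T\<close>.\<close>

lemma self_adjoint_orthonormal_eigenbasis:
  fixes f :: "'a::euclidean_space \<Rightarrow> 'a"
  assumes f: "linear f" and sa: "\<And>x y. inner (f x) y = inner x (f y)"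
    and S: "subspace S" "f ` S \<subseteq> S"
  shows "\<exists>B. B \<subseteq> S \<and> pairwise orthogonal B \<and> span B = S \<and>
             (\<forall>x\<in>B. norm x = 1 \<and> (\<exists>l. f x = l *\<^sub>R x))"
  using S
proof (induction "dim S" arbitrary: S rule: less_induct)
  case (less S)
  show ?case
  proof (cases "S = {0}")
    case True
    then show ?thesis by (intro exI[of _ "{}"]) auto
  next
    case False
    obtain x l where x: "x \<in> S" "norm x = 1" "f x = l *\<^sub>R x"
      using self_adjoint_eigenvector_exists[OF f sa less.prems False] by metis
    define T where "T = {y \<in> S. inner x y = 0}"
    have T: "subspace T"
      using less.prems(1) by (auto simp: T_def subspace_def inner_add_right)
    have fT: "f ` T \<subseteq> T"
      using less.prems(2) by (auto simp: T_def sa[symmetric] x(3))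
    have xT: "x \<notin> T" using x(2) by (auto simp: T_def)
    then have "T \<subset> S" using x(1) unfolding T_def by blast
    then have "dim T < dim S"
      using T less.prems(1) by (intro dim_psubset) (simp add: span_eq_iff[THEN iffD2])
    from less.hyps[OF this T fT] obtain B where
      B: "B \<subseteq> T" "pairwise orthogonal B" "span B = T"
        "\<forall>y\<in>B. norm y = 1 \<and> (\<exists>l. f y = l *\<^sub>R y)"
      by blast
    have "pairwise orthogonal (insert x B)"
      using B(1,2) by (auto simp: pairwise_insert orthogonal_def T_def inner_commute)
    moreover have "span (insert x B) = S"
    proof
      show "span (insert x B) \<subseteq> S"
        using B(1) x(1) less.prems(1) by (intro span_minimal) (auto simp: T_def)
      show "S \<subseteq> span (insert x B)"
      proof
        fix y assume "y \<in> S"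
        then have "y - inner x y *\<^sub>R x \<in> T"
          using x less.prems(1)
          by (auto simp: T_def inner_diff_right norm_eq_1 intro!: subspace_diff subspace_scale)
        then show "y \<in> span (insert x B)"
          using B(3) by (auto simp: span_insert)
      qed
    qed
    ultimately show ?thesis
      using B x by (intro exI[of _ "insert x B"]) (auto simp: T_def)
  qed
qed

lemma symmetric_matrix_diagonalization:
  fixes s :: "real^'n^'n"
  assumes s: "transpose s = s"
  obtains Q d where "orthogonal_matrix Q" "s = Q ** diag_matrix d ** transpose Q"
proof -
  have "inner (s *v x) y = inner x (s *v y)" for x y
    by (metis dot_lmul_matrix s vector_transpose_matrix)
  then obtain B where B: "pairwise orthogonal B" "span B = UNIV"
      "\<And>x. x \<in> B \<Longrightarrow> norm x = 1 \<and> (\<exists>l. s *v x = l *\<^sub>R x)"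
    using self_adjoint_orthonormal_eigenbasis[of "(*v) s" UNIV] by auto
  \<comment> \<open>Unit norm excludes 0 from \<open>B\<close>, so orthogonality gives independence;
    \<open>B\<close> then has as many elements as the index type and can be listed as the columns of
    \<open>Q\<close>.\<close>
  have ind: "independent B"
    using B by (intro pairwise_orthogonal_independent) force+
  then have "finite B" "card B = CARD('n)"
    using B(2) independent_imp_finite indep_card_eq_dim_span[OF ind] by auto
  then obtain b where b: "bij_betw b (UNIV :: 'n set) B"
    by (metis bij_betw_iff_card finite_class.finite_UNIV)
  then have bB: "b j \<in> B" for j by (auto simp: bij_betw_def)
  obtain d where d: "\<And>j. s *v b j = d j *\<^sub>R b j"
    using B(3)[OF bB] by metis
  define Q :: "real^'n^'n" where "Q = (\<chi> i j. b j $ i)"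
  have col: "column j Q = b j" for j by (simp add: column_def Q_def vec_eq_iff)
  \<comment> \<open>Injectivity of \<open>b\<close> turns orthogonality of distinct elements of
    \<open>B\<close> into orthogonality of columns with distinct indices.\<close>
  have Q: "orthogonal_matrix Q"
    unfolding orthogonal_matrix_orthonormal_columns col
    using B(1,3) bB b unfolding pairwise_def bij_betw_def inj_on_def by blast
  have "s ** Q = Q ** diag_matrix (\<chi> j. d j)"
  proof -
    have "(s ** Q) $ i $ j = (s *v b j) $ i" for i j
      by (simp add: matrix_matrix_mult_def matrix_vector_mult_def Q_def)
    then show ?thesis
      by (simp add: vec_eq_iff d matrix_matrix_mult_def diag_matrix_def Q_def if_distrib mult.commute
          cong: if_cong)
  qed
  then have "s = Q ** diag_matrix (\<chi> j. d j) ** transpose Q"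
    using Q by (metis matrix_mul_assoc matrix_mul_rid orthogonal_matrix_def)
  with Q that show ?thesis by blast
qed

section \<open>Determinants in terms of eigenvalues\<close>

text \<open>Over the complex numbers the matrix is \<open>C ** D ** transpose C\<close> with
  \<open>C\<close> the complexified \<open>Q\<close>, and
  \<open>det C * det (transpose C) = 1\<close>. The values \<open>\<i>\<close> and
  \<open>- \<i>\<close> of \<open>c\<close> serve the denominator and the numerator of the Cayley
  transform.\<close>

lemma det_mat_1_plus_scaled_conj:
  fixes Q :: "real^'n^'n" and c :: complex
  assumes Q: "orthogonal_matrix Q"
  shows "det (mat 1 + map_matrix (\<lambda>x. c * complex_of_real x) (Q ** diag_matrix d ** transpose Q)) =
         (\<Prod>i\<in>UNIV. 1 + c * complex_of_real (d $ i))"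
proof -
  define C where "C = map_matrix complex_of_real Q"
  define D :: "complex^'n^'n" where "D = (\<chi> i j. if i = j then 1 + c * complex_of_real (d $ i) else 0)"
  have "C ** transpose C = map_matrix complex_of_real (Q ** transpose Q)"
    by (simp add: C_def vec_eq_iff matrix_matrix_mult_def transpose_def)
  also have "\<dots> = mat 1"
    using Q by (simp add: orthogonal_matrix_def vec_eq_iff mat_def)
  finally have CC: "C ** transpose C = mat 1" .
  have entry: "(Q ** diag_matrix d ** transpose Q) $ i $ j = (\<Sum>k\<in>UNIV. Q $ i $ k * d $ k * Q $ j $ k)"
    for i j
    by (simp add: matrix_matrix_mult_def diag_matrix_def transpose_def if_distrib cong: if_cong)
  have "C ** D ** transpose C =
        C ** transpose C + map_matrix (\<lambda>x. c * complex_of_real x) (Q ** diag_matrix d ** transpose Q)"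
    by (simp add: vec_eq_iff entry)
       (simp add: C_def D_def matrix_matrix_mult_def transpose_def if_distrib sum_distrib_left
          algebra_simps sum.distrib cong: if_cong)
  then have "det (mat 1 + map_matrix (\<lambda>x. c * complex_of_real x) (Q ** diag_matrix d ** transpose Q)) =
        det C * det D * det (transpose C)"
    by (metis CC det_mul)
  also have "\<dots> = det (C ** transpose C) * det D"
    by (simp add: det_mul)
  also have "\<dots> = (\<Prod>i\<in>UNIV. 1 + c * complex_of_real (d $ i))"
    by (simp add: CC, subst det_diagonal) (simp_all add: D_def)
  finally show ?thesis .
qed

lemma det_matrix_inv:
  fixes A :: "'a::field^'n^'n"
  assumes "invertible A"
  shows "det (matrix_inv A) = inverse (det A)"
proof -
  have "A ** matrix_inv A = mat 1"
    using assms unfolding invertible_def matrix_inv_def by (rule someI2_ex) blast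
  then have "det A * det (matrix_inv A) = 1"
    by (metis det_I det_mul)
  then show ?thesis
    by (metis inverse_unique)
qed

section \<open>Scalar Cayley transform and the logarithm of the determinant\<close>

lemma one_plus_i_eq_exp_arctan:
  "1 + \<i> * complex_of_real x = complex_of_real (sqrt (1 + x\<^sup>2)) * exp (\<i> * complex_of_real (arctan x))"
  by (simp add: complex_eq_iff exp_Euler cos_of_real sin_of_real cos_arctan sin_arctan
      add_nonneg_eq_0_iff)

lemma cayley_factor_eq_exp_arctan:
  "(1 - \<i> * complex_of_real x) / (1 + \<i> * complex_of_real x) =
   exp (- 2 * \<i> * complex_of_real (arctan x))"
proof -
  have r: "sqrt (1 + x\<^sup>2) \<noteq> 0"
    by (smt (verit) real_sqrt_eq_zero_cancel_iff zero_le_power2)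
  \<comment> \<open>The polar form at \<open>- x\<close>: \<open>arctan\<close> is odd and the
    modulus is unchanged, so the moduli cancel in the quotient.\<close>
  have "1 - \<i> * complex_of_real x =
        complex_of_real (sqrt (1 + x\<^sup>2)) * exp (- (\<i> * complex_of_real (arctan x)))"
    using one_plus_i_eq_exp_arctan[of "-x"] by (simp add: arctan_minus)
  then have "(1 - \<i> * complex_of_real x) / (1 + \<i> * complex_of_real x) =
        exp (- (\<i> * complex_of_real (arctan x))) / exp (\<i> * complex_of_real (arctan x))"
    using r by (simp add: one_plus_i_eq_exp_arctan)
  also have "\<dots> = exp (- 2 * \<i> * complex_of_real (arctan x))"
    by (simp add: mult.assoc flip: exp_diff)
  finally show ?thesis .
qed

lemma det_cayley_eq_exp:
  fixes s :: "real^'n^'n"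
  assumes s: "transpose s = s"
  shows "det (cayley s) = exp (- 2 * \<i> * complex_of_real (trace (arctan_matrix s)))"
proof -
  obtain Q d where Q: "orthogonal_matrix Q" and sQ: "s = Q ** diag_matrix d ** transpose Q"
    using symmetric_matrix_diagonalization[OF s] .
  \<comment> \<open>Cyclicity of the trace brings \<open>transpose Q\<close> next to
    \<open>Q\<close>, where they cancel.\<close>
  have "trace (arctan_matrix s) = trace (transpose Q ** (Q ** diag_matrix (\<chi> i. arctan (d $ i))))"
    unfolding arctan_matrix_def sQ sym_matrix_fun_eqI[OF Q] by (rule trace_mul_sym)
  also have "\<dots> = (\<Sum>i\<in>UNIV. arctan (d $ i))"
    using Q by (simp add: matrix_mul_assoc orthogonal_matrix_def trace_def diag_matrix_def)
  finally have tr: "trace (arctan_matrix s) = (\<Sum>i\<in>UNIV. arctan (d $ i))" .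
  have "mat 1 - map_matrix (\<lambda>x. \<i> * complex_of_real x) s =
        mat 1 + map_matrix (\<lambda>x. - \<i> * complex_of_real x) s"
    by (simp add: vec_eq_iff)
  then have "det (cayley s) =
        (\<Prod>i\<in>UNIV. 1 + (- \<i>) * complex_of_real (d $ i)) / (\<Prod>i\<in>UNIV. 1 + \<i> * complex_of_real (d $ i))"
    unfolding cayley_def det_mul det_matrix_inv[OF invertible_id_plus_i[OF s]] divide_inverse
    by (simp only: sQ det_mat_1_plus_scaled_conj[OF Q])
  also have "\<dots> = (\<Prod>i\<in>UNIV. exp (- 2 * \<i> * complex_of_real (arctan (d $ i))))"
    by (simp add: cayley_factor_eq_exp_arctan flip: prod_dividef)
  also have "\<dots> = exp (- 2 * \<i> * complex_of_real (trace (arctan_matrix s)))"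
    by (simp add: tr sum_distrib_left flip: exp_sum)
  finally show ?thesis .
qed

lemma exp_i_eq_iff_rcong:
  "exp (\<i> * complex_of_real x) = exp (\<i> * complex_of_real y) \<longleftrightarrow> [x = y] (rmod (2 * pi))"
proof -
  \<comment> \<open>Matches the period \<open>2 * pi * \<i>\<close> of \<open>exp\<close> with the
    real modulus; \<open>rcong_altdef\<close> yields the congruence with its sides swapped.\<close>
  have "\<i> * complex_of_real x = \<i> * complex_of_real y + (of_int (2 * n) * pi) * \<i> \<longleftrightarrow>
        x = y + of_int n * (2 * pi)" for n
    by (simp add: complex_eq_iff mult.commute mult.left_commute)
  then have "exp (\<i> * complex_of_real x) = exp (\<i> * complex_of_real y) \<longleftrightarrow>
        [y = x] (rmod (2 * pi))"
    unfolding exp_eq rcong_altdef by blast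
  then show ?thesis
    by (simp only: rcong_sym_iff)
qed

theorem lemma4p4:
  fixes s :: "real^'n^'n"
  assumes "transpose s = s"
  shows "(\<exists>k::int. Ln (det (cayley s)) =
            - 2 * \<i> * complex_of_real (trace (arctan_matrix s)) + 2 * complex_of_real pi * \<i> * of_int k) \<and>
         (\<forall>\<theta>::real. is_plane_angle (lagrangian_plane s) reference_plane \<theta> \<longleftrightarrow>
            [\<theta> = - 2 * trace (arctan_matrix s)] (rmod (2 * pi)))"
proof (intro conjI allI)
  let ?t = "trace (arctan_matrix s)"
  have det: "det (cayley s) = exp (- 2 * \<i> * complex_of_real ?t)"
    using det_cayley_eq_exp[OF assms] .
  \<comment> \<open>The determinant is an exponential, hence nonzero, so \<open>exp\<close> undoes
    \<open>Ln\<close>; equal exponentials then supply \<open>k\<close>.\<close>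
  have "exp (Ln (det (cayley s))) = exp (- 2 * \<i> * complex_of_real ?t)"
    by (simp add: det)
  then show "\<exists>k::int. Ln (det (cayley s)) =
      - 2 * \<i> * complex_of_real ?t + 2 * complex_of_real pi * \<i> * of_int k"
    unfolding exp_eq by (simp add: mult_ac)
  fix \<theta> :: real
  \<comment> \<open>By \<open>lagrangian_plane_inj\<close> the matrix quantified in
    \<open>is_plane_angle\<close> can only be \<open>s\<close>.\<close>
  have "is_plane_angle (lagrangian_plane s) reference_plane \<theta> \<longleftrightarrow>
        exp (\<i> * complex_of_real \<theta>) = det (cayley s)"
    unfolding is_plane_angle_def using assms lagrangian_plane_inj by metis
  also have "\<dots> \<longleftrightarrow> exp (\<i> * complex_of_real \<theta>) = exp (\<i> * complex_of_real (- 2 * ?t))"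
    by (simp add: det mult_ac)
  finally show "is_plane_angle (lagrangian_plane s) reference_plane \<theta> \<longleftrightarrow>
      [\<theta> = - 2 * ?t] (rmod (2 * pi))"
    unfolding exp_i_eq_iff_rcong .
qed

end
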